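(* Let $\mathbf{C}_1$ be a cycle poset with underlying crown $\mathscr{C}_1$, let $\mathcal{T}=\{(\mathbf{T}_v,r_v)\mid v\in\mathbf{C}_1\}$ be a family of rooted tree posets indexed by $\mathbf{C}_1$, and let $P$ be the unicycle poset obtained as the grafting of $\mathcal{T}$ on $\mathbf{C}_1$. Then the following three linear orders form a realizer of $P$: $$A_1(X^-)\, B_{2}(Z^\bullet)\, I_{x}^+,$$ $$I_{z}^-\, A_2(X^\bullet)\, B_1(Z^+),$$ $$I_{x}^-\, X^+\, C_1\, C_2\, Z^-\, I_{z}^+.$$
   Context: All posets are finite. Linear orders on a finite set are written as words, listing elements from smallest to largest; juxtaposition is concatenation. $\prod^{\nearrow}_{a\le i\le b}w_i=w_aw_{a+1}\cdots w_b$ and $\prod^{\searrow}_{a\le i\le b}w_i=w_bw_{b-1}\cdots w_a$. A realizer of a poset $P$ is a list of linear extensions of $P$ (repetitions allowed) such that $u\le v$ in $P$ if and only if $u\le v$ in each of them. The cover graph of a poset is its undirected Hasse diagram; a tree poset is a poset whose cover graph is a tree; a rooted tree poset is a pair $(\mathbf{T},r)$ with $\mathbf{T}$ a tree poset and $r\in\mathbf{T}$. Tree notation. Let $\mathbf{T}$ be a tree poset and $w\in\mathbf{T}$. Each $t\ne w$ is joined to $w$ by a unique path in the cover graph. $\mathbf{U}_w$ (resp. $\mathbf{D}_w$) is the set of $t\in\mathbf{T}\setminus\{w\}$ for which the path from $w$ to $t$ starts with a step to an element greater (resp. smaller) than $w$. Put $\mathbf{U}_w^+=\{t\in\mathbf{U}_w: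 t>w\}$, $\mathbf{U}_w^-=\mathbf{U}_w\setminus\mathbf{U}_w^+$, $\mathbf{D}_w^-=\{t\in\mathbf{D}_w: t<w\}$, $\mathbf{D}_w^+=\mathbf{D}_w\setminus\mathbf{D}_w^-$. Admissible words at $w$ in $\mathbf{T}$ are: linear extensions $U_w^-,U_w^+$ of $\mathbf{U}_w^-,\mathbf{U}_w^+$ and $U_{w,1},U_{w,2}$ of $\mathbf{U}_w$ such that $U_w^-\,w\,U_w^+$, $w\,U_{w,1}$, $w\,U_{w,2}$ form a realizer of $\mathbf{U}_w\cup\{w\}$; and linear extensions $D_w^-,D_w^+$ of $\mathbf{D}_w^-,\mathbf{D}_w^+$ and $D_{w,1},D_{w,2}$ of $\mathbf{D}_w$ such that $D_w^-\,w\,D_w^+$, $D_{w,1}\,w$, $D_{w,2}\,w$ form a realizer of $\mathbf{D}_w\cup\{w\}$. (Admissible words always exist.) Cycle posets. The crown $\mathscr{C}_1$ is the square poset on four elements with minimum $x$, maximum $z$ and two incomparable elements $a,b$. A cycle poset $\mathbf{C}_1$ with underlying crown $\mathscr{C}_1$ is a subdivision of it: it has a minimum $x$, a maximum $z$, and consists of two maximal chains $x\lessdot y_1^p\lessdot\cdots\lessdot y_{k_p}^p\lessdot z$, $p=1,2$, with $k_1,k_2\ge1$ (the one for $p=1$ containing $a$, the one for $p=2$ containing $b$), where every $y_i^1$ is incomparable to every $y_j^2$. Grafting. Given a family $\{(\mathbf{T}_v,r_v)\mid v\in Q\}$ of rooted tree posets indexed by a poset $Q$, the grafting on $Q$ is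 the poset on $\{(v,t): v\in Q, t\in\mathbf{T}_v\}$ with $(a,b)\le(c,d)$ iff either $a=c$ and $b\le d$ in $\mathbf{T}_a$, or $a<c$ in $Q$, $b\le r_a$ in $\mathbf{T}_a$ and $r_c\le d$ in $\mathbf{T}_c$. We identify $v$ with $(v,r_v)$ and $\mathbf{T}_v$ with $\{v\}\times\mathbf{T}_v$, so that $v$ is the root of $\mathbf{T}_v$. Words. For every $v\in\mathbf{C}_1$ fix admissible words at $v$ in $\mathbf{T}_v$. For $w\in\{x,z\}$ put $I_w^-=U_w^-\,D_{w,1}$ and $I_w^+=U_{w,1}\,D_w^+$; put $X^+=x\,U_{x}^+$, $X^-=D_{x}^-\,x$, $X^\bullet=D_{x,2}\,x\,U_{x,2}$, and likewise $Z^+=z\,U_{z}^+$, $Z^-=D_{z}^-\,z$, $Z^\bullet=D_{z,2}\,z\,U_{z,2}$. For $p\in\{1,2\}$ and any word $W$ put $$A_p(W)=\prod^{\searrow}_{1\le j\le k_p}\big(U_{y_j^p}^-\,D_{y_j^p,1}\big)\;W\;\prod^{\nearrow}_{1\le j\le k_p}\big(y_j^p\,U_{y_j^p}^+\big),$$ $$B_p(W)=\prod^{\nearrow}_{1\le j\le k_p}\big(D_{y_j^p}^-\,y_j^p\big)\;W\;\prod^{\searrow}_{1\le j\le k_p}\big(U_{y_j^p,1}\,D_{y_j^p}^+\big),$$ $$C_p=\prod^{\nearrow}_{1\le j\le k_p}\big(D_{y_j^p,2}\,y_j^p\,U_{y_j^p,2}\big).$$ *)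

theory Defs
  imports Main
begin

text \<open>
  A finite poset is a finite carrier \<open>A\<close> together with a relation \<open>r\<close> such that
  \<open>partial_order_on A r\<close>; \<open>(u, v) \<in> r\<close> is read \<open>u \<le> v\<close>. A subset \<open>S\<close> of the carrier
  is regarded as a poset with the induced order. Linear orders are represented by lists without
  repetition, from smallest to largest element.
\<close>

section \<open>Linear extensions and realizers\<close>

definition word_order :: "'a list \<Rightarrow> 'a rel" where
  "word_order w = {(w ! i, w ! j) | i j. i \<le> j \<and> j < length w}"

definition linear_extension :: "'a set \<Rightarrow> 'a rel \<Rightarrow> 'a list \<Rightarrow> bool" where
  "linear_extension S r w \<longleftrightarrow>
     distinct w \<and> set w = S \<and> (\<forall>u\<in>S. \<forall>v\<in>S. (u, v) \<in> r \<longrightarrow> (u, v) \<in> word_order w)"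

definition realizer :: "'a set \<Rightarrow> 'a rel \<Rightarrow> 'a list list \<Rightarrow> bool" where
  "realizer S r ws \<longleftrightarrow>
     (\<forall>w\<in>set ws. linear_extension S r w) \<and>
     (\<forall>u\<in>S. \<forall>v\<in>S. (u, v) \<in> r \<longleftrightarrow> (\<forall>w\<in>set ws. (u, v) \<in> word_order w))"

section \<open>Cover graphs and tree posets\<close>

definition covers :: "'a rel \<Rightarrow> 'a \<Rightarrow> 'a \<Rightarrow> bool" where
  "covers r u v \<longleftrightarrow> (u, v) \<in> r \<and> u \<noteq> v \<and>
     \<not> (\<exists>t. t \<noteq> u \<and> t \<noteq> v \<and> (u, t) \<in> r \<and> (t, v) \<in> r)"

definition cover_adj :: "'a rel \<Rightarrow> 'a \<Rightarrow> 'a \<Rightarrow> bool" where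
  "cover_adj r u v \<longleftrightarrow> covers r u v \<or> covers r v u"

definition cover_path :: "'a set \<Rightarrow> 'a rel \<Rightarrow> 'a \<Rightarrow> 'a list \<Rightarrow> 'a \<Rightarrow> bool" where
  "cover_path A r u p v \<longleftrightarrow>
     p \<noteq> [] \<and> hd p = u \<and> last p = v \<and> set p \<subseteq> A \<and> distinct p \<and> successively (cover_adj r) p"

definition cover_cycle :: "'a set \<Rightarrow> 'a rel \<Rightarrow> 'a list \<Rightarrow> bool" where
  "cover_cycle A r p \<longleftrightarrow>
     3 \<le> length p \<and> set p \<subseteq> A \<and> distinct p \<and> successively (cover_adj r) p \<and>
     cover_adj r (last p) (hd p)"

definition tree_poset :: "'a set \<Rightarrow> 'a rel \<Rightarrow> bool" where
  "tree_poset A r \<longleftrightarrow>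
     finite A \<and> A \<noteq> {} \<and> partial_order_on A r \<and>
     (\<forall>u\<in>A. \<forall>v\<in>A. \<exists>p. cover_path A r u p v) \<and> (\<nexists>p. cover_cycle A r p)"

definition rooted_tree_poset :: "'a set \<Rightarrow> 'a rel \<Rightarrow> 'a \<Rightarrow> bool" where
  "rooted_tree_poset A r q \<longleftrightarrow> tree_poset A r \<and> q \<in> A"

text \<open>
  In a tree poset the path quantified existentially here is the unique path from \<open>w\<close> to \<open>t\<close>,
  and \<open>s\<close> is its second vertex.
\<close>

definition U_set :: "'a set \<Rightarrow> 'a rel \<Rightarrow> 'a \<Rightarrow> 'a set" where
  "U_set A r w = {t \<in> A - {w}. \<exists>s p. cover_path A r w (w # s # p) t \<and> s \<noteq> w \<and> (w, s) \<in> r}"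

definition D_set :: "'a set \<Rightarrow> 'a rel \<Rightarrow> 'a \<Rightarrow> 'a set" where
  "D_set A r w = {t \<in> A - {w}. \<exists>s p. cover_path A r w (w # s # p) t \<and> s \<noteq> w \<and> (s, w) \<in> r}"

definition U_plus_set :: "'a set \<Rightarrow> 'a rel \<Rightarrow> 'a \<Rightarrow> 'a set" where
  "U_plus_set A r w = {t \<in> U_set A r w. t \<noteq> w \<and> (w, t) \<in> r}"

definition U_minus_set :: "'a set \<Rightarrow> 'a rel \<Rightarrow> 'a \<Rightarrow> 'a set" where
  "U_minus_set A r w = U_set A r w - U_plus_set A r w"

definition D_minus_set :: "'a set \<Rightarrow> 'a rel \<Rightarrow> 'a \<Rightarrow> 'a set" where
  "D_minus_set A r w = {t \<in> D_set A r w. t \<noteq> w \<and> (t, w) \<in> r}"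

definition D_plus_set :: "'a set \<Rightarrow> 'a rel \<Rightarrow> 'a \<Rightarrow> 'a set" where
  "D_plus_set A r w = D_set A r w - D_minus_set A r w"

section \<open>Admissible words\<close>

datatype 'a words =
  Words (U_minus: "'a list") (U_plus: "'a list") (U_1: "'a list") (U_2: "'a list")
        (D_minus: "'a list") (D_plus: "'a list") (D_1: "'a list") (D_2: "'a list")

definition admissible_words :: "'a set \<Rightarrow> 'a rel \<Rightarrow> 'a \<Rightarrow> 'a words \<Rightarrow> bool" where
  "admissible_words A r w a \<longleftrightarrow>
     linear_extension (U_minus_set A r w) r (U_minus a) \<and>
     linear_extension (U_plus_set A r w) r (U_plus a) \<and>
     linear_extension (U_set A r w) r (U_1 a) \<and>
     linear_extension (U_set A r w) r (U_2 a) \<and>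
     realizer (U_set A r w \<union> {w}) r [U_minus a @ [w] @ U_plus a, [w] @ U_1 a, [w] @ U_2 a] \<and>
     linear_extension (D_minus_set A r w) r (D_minus a) \<and>
     linear_extension (D_plus_set A r w) r (D_plus a) \<and>
     linear_extension (D_set A r w) r (D_1 a) \<and>
     linear_extension (D_set A r w) r (D_2 a) \<and>
     realizer (D_set A r w \<union> {w}) r [D_minus a @ [w] @ D_plus a, D_1 a @ [w], D_2 a @ [w]]"

section \<open>Cycle posets over the square crown\<close>

text \<open>
  \<open>Y1\<close> and \<open>Y2\<close> list the elements strictly between \<open>x\<close> and \<open>z\<close> on the two maximal chains,
  from bottom to top.
\<close>

definition cycle_poset :: "'b set \<Rightarrow> 'b rel \<Rightarrow> 'b \<Rightarrow> 'b \<Rightarrow> 'b list \<Rightarrow> 'b list \<Rightarrow> bool" where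
  "cycle_poset Q r x z Y1 Y2 \<longleftrightarrow>
     partial_order_on Q r \<and>
     Q = set ([x] @ Y1 @ [z]) \<union> set ([x] @ Y2 @ [z]) \<and>
     (\<forall>v\<in>Q. (x, v) \<in> r) \<and> (\<forall>v\<in>Q. (v, z) \<in> r) \<and>
     Y1 \<noteq> [] \<and> Y2 \<noteq> [] \<and>
     successively (covers r) ([x] @ Y1 @ [z]) \<and>
     successively (covers r) ([x] @ Y2 @ [z]) \<and>
     (\<forall>u\<in>set Y1. \<forall>v\<in>set Y2. (u, v) \<notin> r \<and> (v, u) \<notin> r)"

section \<open>Grafting\<close>

definition graft_carrier :: "'b set \<Rightarrow> ('b \<Rightarrow> 'c set) \<Rightarrow> ('b \<times> 'c) set" where
  "graft_carrier Q T = (SIGMA v:Q. T v)"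

definition graft_order ::
    "'b set \<Rightarrow> 'b rel \<Rightarrow> ('b \<Rightarrow> 'c set) \<Rightarrow> ('b \<Rightarrow> 'c rel) \<Rightarrow> ('b \<Rightarrow> 'c) \<Rightarrow> ('b \<times> 'c) rel" where
  "graft_order Q r T R \<rho> =
     {((a, b), (c, d)) | a b c d.
        (a, b) \<in> graft_carrier Q T \<and> (c, d) \<in> graft_carrier Q T \<and>
        (a = c \<and> (b, d) \<in> R a \<or>
         a \<noteq> c \<and> (a, c) \<in> r \<and> (b, \<rho> a) \<in> R a \<and> (\<rho> c, d) \<in> R c)}"

section \<open>The words on the grafting\<close>

text \<open>
  Here \<open>q v\<close> is the element of the grafting that is identified with \<open>v\<close>, and \<open>W v\<close> the chosen
  words at \<open>v\<close>, both consisting of elements of the grafting. Below, \<open>up_prod Y f\<close> is the product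
  of the \<open>f y\<close> in the order of \<open>Y\<close> and \<open>down_prod Y f\<close> the product in the reverse order.
\<close>

definition up_prod :: "'b list \<Rightarrow> ('b \<Rightarrow> 'p list) \<Rightarrow> 'p list" where
  "up_prod Y f = concat (map f Y)"

definition down_prod :: "'b list \<Rightarrow> ('b \<Rightarrow> 'p list) \<Rightarrow> 'p list" where
  "down_prod Y f = concat (map f (rev Y))"

definition I_minus :: "('b \<Rightarrow> 'p words) \<Rightarrow> 'b \<Rightarrow> 'p list" where
  "I_minus W w = U_minus (W w) @ D_1 (W w)"

definition I_plus :: "('b \<Rightarrow> 'p words) \<Rightarrow> 'b \<Rightarrow> 'p list" where
  "I_plus W w = U_1 (W w) @ D_plus (W w)"

text \<open>The next three are the words \<open>X\<^sup>+\<close>, \<open>X\<^sup>-\<close>, \<open>X\<^sup>\<bullet>\<close> for \<open>w = x\<close>, and similarly for \<open>z\<close>.\<close>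

definition E_plus :: "('b \<Rightarrow> 'p) \<Rightarrow> ('b \<Rightarrow> 'p words) \<Rightarrow> 'b \<Rightarrow> 'p list" where
  "E_plus q W w = [q w] @ U_plus (W w)"

definition E_minus :: "('b \<Rightarrow> 'p) \<Rightarrow> ('b \<Rightarrow> 'p words) \<Rightarrow> 'b \<Rightarrow> 'p list" where
  "E_minus q W w = D_minus (W w) @ [q w]"

definition E_bullet :: "('b \<Rightarrow> 'p) \<Rightarrow> ('b \<Rightarrow> 'p words) \<Rightarrow> 'b \<Rightarrow> 'p list" where
  "E_bullet q W w = D_2 (W w) @ [q w] @ U_2 (W w)"

definition A_word :: "('b \<Rightarrow> 'p) \<Rightarrow> ('b \<Rightarrow> 'p words) \<Rightarrow> 'b list \<Rightarrow> 'p list \<Rightarrow> 'p list" where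
  "A_word q W Y V =
     down_prod Y (\<lambda>y. U_minus (W y) @ D_1 (W y)) @ V @ up_prod Y (\<lambda>y. [q y] @ U_plus (W y))"

definition B_word :: "('b \<Rightarrow> 'p) \<Rightarrow> ('b \<Rightarrow> 'p words) \<Rightarrow> 'b list \<Rightarrow> 'p list \<Rightarrow> 'p list" where
  "B_word q W Y V =
     up_prod Y (\<lambda>y. D_minus (W y) @ [q y]) @ V @ down_prod Y (\<lambda>y. U_1 (W y) @ D_plus (W y))"

definition C_word :: "('b \<Rightarrow> 'p) \<Rightarrow> ('b \<Rightarrow> 'p words) \<Rightarrow> 'b list \<Rightarrow> 'p list" where
  "C_word q W Y = up_prod Y (\<lambda>y. D_2 (W y) @ [q y] @ U_2 (W y))"

end

theory Submission
  imports Defs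
begin

text \<open>
  An element of the grafting on a cycle poset is seen from the other trees only through its
  position relative to the root of its own tree: for \<open>v < v'\<close>, an element \<open>s\<close> of the tree at \<open>v\<close> is
  below an element \<open>t\<close> of the tree at \<open>v'\<close> if and only if \<open>s\<close> is below the root \<open>v\<close> and \<open>t\<close> is
  above the root \<open>v'\<close>.

  Inside one tree with root \<open>w\<close>, the three words restrict, in an order that depends on \<open>w\<close>,
  to \<open>U\<^sup>- D\<^sub>1 w U\<^sup>+\<close>, \<open>D\<^sup>- w U\<^sub>1 D\<^sup>+\<close> and \<open>D\<^sub>2 w U\<^sub>2\<close>. These realize the tree
  (\<open>admissible_words_realizer\<close>): pairs on the same side of \<open>w\<close> are settled by admissibility, and an
  element of \<open>D\<close> can be comparable to one of \<open>U\<close> only through \<open>w\<close>, because removing \<open>w\<close>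
  separates \<open>D\<close> from \<open>U\<close> in the cover graph (\<open>tree_poset_through_root\<close>).

  The first two of these restrictions can be cut next to \<open>w\<close>, the first so that the elements above
  \<open>w\<close> form its end, the second so that the elements below \<open>w\<close> form its beginning. The words of the
  theorem interleave the pieces of different trees so that, for \<open>v < v'\<close>, one word places everything
  at \<open>v'\<close> that is not above \<open>v'\<close> before the tree at \<open>v\<close>, and one word places everything at \<open>v\<close> that
  is not below \<open>v\<close> after the tree at \<open>v'\<close>. This inverts exactly the pairs that are incomparable
  for \<open>v < v'\<close>, while trees at incomparable vertices appear in both orders
  (\<open>cycle_blocks_realizer\<close>).
\<close>

section \<open>Words as linear orders\<close>

lemma word_order_Nil [simp]: "word_order [] = {}"
  by (simp add: word_order_def)

lemma word_order_Cons: "word_order (a # w) = insert (a, a) ({a} \<times> set w \<union> word_order w)"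
proof (intro set_eqI iffI)
  fix p assume "p \<in> word_order (a # w)"
  then obtain i j where "p = ((a # w) ! i, (a # w) ! j)" "i \<le> j" "j < length (a # w)"
    unfolding word_order_def by blast
  then show "p \<in> insert (a, a) ({a} \<times> set w \<union> word_order w)"
    by (cases i; cases j) (auto simp: word_order_def)
next
  fix p assume "p \<in> insert (a, a) ({a} \<times> set w \<union> word_order w)"
  then consider "p = (a, a)" | b where "p = (a, b)" "b \<in> set w" | "p \<in> word_order w" by auto
  then show "p \<in> word_order (a # w)"
  proof cases
    case 1
    then show ?thesis unfolding word_order_def by (auto intro!: exI[of _ 0])
  next
    case 2
    then obtain j where "j < length w" "w ! j = b" by (auto simp: in_set_conv_nth)
    with 2 have "p = ((a # w) ! 0, (a # w) ! Suc j) \<and> 0 \<le> Suc j \<and> Suc j < length (a # w)" by simp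
    then show ?thesis unfolding word_order_def by blast
  next
    case 3
    then obtain i j where "p = (w ! i, w ! j)" "i \<le> j" "j < length w"
      unfolding word_order_def by blast
    then have "p = ((a # w) ! Suc i, (a # w) ! Suc j) \<and> Suc i \<le> Suc j \<and> Suc j < length (a # w)" by simp
    then show ?thesis unfolding word_order_def by blast
  qed
qed

lemma word_order_append:
  "word_order (v @ w) = word_order v \<union> word_order w \<union> set v \<times> set w"
  by (induction v) (auto simp: word_order_Cons)

lemma word_order_in_set: "(u, v) \<in> word_order w \<Longrightarrow> u \<in> set w \<and> v \<in> set w"
  by (induction w) (auto simp: word_order_Cons)

lemma word_order_notin:
  "u \<notin> set w \<Longrightarrow> (u, v) \<notin> word_order w" "v \<notin> set w \<Longrightarrow> (u, v) \<notin> word_order w"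
  by (auto dest: word_order_in_set)

lemma word_order_skip:
  assumes "u \<notin> set m" "v \<notin> set m"
  shows "(u, v) \<in> word_order (p @ m @ q) \<longleftrightarrow> (u, v) \<in> word_order (p @ q)"
  using assms by (auto simp: word_order_append dest: word_order_in_set)

lemma word_order_total:
  "u \<in> set w \<Longrightarrow> v \<in> set w \<Longrightarrow> (u, v) \<in> word_order w \<or> (v, u) \<in> word_order w"
  by (induction w) (auto simp: word_order_Cons)

lemma word_order_antisym:
  "distinct w \<Longrightarrow> (u, v) \<in> word_order w \<Longrightarrow> (v, u) \<in> word_order w \<Longrightarrow> u = v"
  by (induction w) (auto simp: word_order_Cons dest: word_order_in_set)

lemma word_order_rev: "word_order (rev w) = (word_order w)\<inverse>"
  by (induction w) (auto simp: word_order_Cons word_order_append)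

lemma word_order_sorted_wrt:
  "sorted_wrt P w \<Longrightarrow> (u, v) \<in> word_order w \<Longrightarrow> u \<noteq> v \<Longrightarrow> P u v"
  by (induction w) (auto simp: word_order_Cons)

lemma realizerI:
  assumes "\<And>w. w \<in> set ws \<Longrightarrow> distinct w \<and> set w = S"
    and "\<And>u v. u \<in> S \<Longrightarrow> v \<in> S \<Longrightarrow> (u, v) \<in> r \<longleftrightarrow> (\<forall>w\<in>set ws. (u, v) \<in> word_order w)"
  shows "realizer S r ws"
  using assms unfolding realizer_def linear_extension_def by blast

section \<open>Words over a disjoint union\<close>

text \<open>
  The subword of \<open>L\<close> on the component with index \<open>v\<close>. A word on a disjoint union is repetition-free,
  exhausts the union and orders pairs in one component correctly as soon as its fibres do so.
\<close>

definition fibre :: "'b \<Rightarrow> ('b \<times> 'c) list \<Rightarrow> 'c list" where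
  "fibre v L = map snd (filter (\<lambda>u. fst u = v) L)"

lemma fibre_append [simp]: "fibre v (L @ M) = fibre v L @ fibre v M"
  by (simp add: fibre_def)

lemma fibre_map_Pair [simp]: "fibre v (map (Pair a) w) = (if a = v then w else [])"
  by (induction w) (auto simp: fibre_def)

lemma set_fibre [simp]: "t \<in> set (fibre v L) \<longleftrightarrow> (v, t) \<in> set L"
  by (force simp: fibre_def)

lemma distinct_if_fibres_distinct: "(\<And>v. distinct (fibre v L)) \<Longrightarrow> distinct L"
proof (induction L)
  case (Cons u L)
  obtain a b where u: "u = (a, b)" by (cases u)
  have "distinct (fibre v L)" for v
    using Cons.prems[of v] by (auto simp: fibre_def split: if_splits)
  moreover have "u \<notin> set L"
    using Cons.prems[of a] set_fibre[of b a L] by (simp add: fibre_def u)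
  ultimately show ?case using Cons.IH by simp
qed simp

lemma word_order_fibre:
  "((v, s), (v, t)) \<in> word_order L \<longleftrightarrow> (s, t) \<in> word_order (fibre v L)"
proof (induction L)
  case (Cons u L)
  have "t \<in> set (fibre v L) \<longleftrightarrow> (v, t) \<in> set L" by simp
  with Cons show ?case
    by (cases u) (auto simp: fibre_def word_order_Cons)
qed (simp add: fibre_def)

lemma fibre_concat:
  "distinct Y \<Longrightarrow> fibre v (concat (map (\<lambda>y. map (Pair y) (f y)) Y)) = (if v \<in> set Y then f v else [])"
  by (induction Y) (auto simp: fibre_def[of _ "[]"])

lemma word_order_concat:
  assumes "a \<noteq> c"
  shows "((a, b), (c, d)) \<in> word_order (concat (map (\<lambda>y. map (Pair y) (f y)) Y)) \<longleftrightarrow>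
    (a, c) \<in> word_order Y \<and> b \<in> set (f a) \<and> d \<in> set (f c)"
  using assms
  by (induction Y) (auto simp: word_order_Cons word_order_append dest: word_order_in_set)

lemma word_order_map_Pair:
  "a \<noteq> c \<Longrightarrow> ((a, b), (c, d)) \<notin> word_order (map (Pair v) w)"
  by (auto dest: word_order_in_set)

lemma in_set_map_Pair: "(a, b) \<in> set (map (Pair v) w) \<longleftrightarrow> a = v \<and> b \<in> set w"
  by auto

lemma in_set_concat_map_Pair:
  "(a, b) \<in> set (concat (map (\<lambda>y. map (Pair y) (f y)) Y)) \<longleftrightarrow> a \<in> set Y \<and> b \<in> set (f a)"
  by auto

section \<open>The two sides of a vertex in a tree poset\<close>

lemma in_U_set: "t \<in> U_set A r w \<Longrightarrow> t \<in> A \<and> t \<noteq> w"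
  and in_D_set: "t \<in> D_set A r w \<Longrightarrow> t \<in> A \<and> t \<noteq> w"
  by (auto simp: U_set_def D_set_def)

lemma cover_adj_sym: "cover_adj r u v \<Longrightarrow> cover_adj r v u"
  by (auto simp: cover_adj_def)

lemma cover_path_second:
  assumes "cover_path A r w p t" "t \<noteq> w"
  obtains s p' where "p = w # s # p'" "cover_adj r w s" "s \<noteq> w"
proof -
  obtain p0 where p0: "p = w # p0" using assms unfolding cover_path_def by (cases p) auto
  with assms obtain s p' where "p0 = s # p'" unfolding cover_path_def by (cases p0) auto
  with p0 assms that show thesis unfolding cover_path_def by auto
qed

lemma tree_poset_decomposition:
  assumes "tree_poset A r" "w \<in> A"
  shows "A = insert w (U_set A r w \<union> D_set A r w)"
proof
  show "A \<subseteq> insert w (U_set A r w \<union> D_set A r w)"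
  proof
    fix t assume t: "t \<in> A"
    then obtain p where p: "cover_path A r w p t" using assms unfolding tree_poset_def by blast
    show "t \<in> insert w (U_set A r w \<union> D_set A r w)"
    proof (cases "t = w")
      case False
      then obtain s p' where "p = w # s # p'" "cover_adj r w s" "s \<noteq> w"
        using cover_path_second[OF p] by blast
      with p t False show ?thesis
        unfolding U_set_def D_set_def cover_adj_def covers_def by auto
    qed simp
  qed
qed (use assms(2) in \<open>auto dest: in_U_set in_D_set\<close>)

text \<open>
  Following the first path from \<open>s\<close> up to its first vertex \<open>m\<close> on the second path, and from there
  the second path back to \<open>s'\<close>, gives a path from \<open>s\<close> to \<open>s'\<close> that avoids \<open>w\<close>; it closes up
  through \<open>w\<close>.
\<close>

lemma two_first_steps_cycle:
  assumes "cover_path A r w (w # s # p) t" "cover_path A r w (w # s' # p') t" "s \<noteq> s'"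
  shows "\<exists>c. cover_cycle A r c"
proof -
  let ?p = "s # p" and ?p' = "s' # p'"
  have "t \<in> set ?p" "t \<in> set ?p'"
    using assms(1,2) last_in_set[of ?p] last_in_set[of ?p'] unfolding cover_path_def by auto
  then have "\<exists>m\<in>set ?p. m \<in> set ?p'" by blast
  then obtain a m b where ab: "?p = a @ m # b" and m: "m \<in> set ?p'"
    and a: "\<forall>k\<in>set a. k \<notin> set ?p'" by (rule split_list_first_propE)
  obtain c d where cd: "?p' = c @ m # d" using split_list[OF m] by blast
  let ?c = "w # a @ m # rev c"
  have succ1: "successively (cover_adj r) (w # a @ m # b)"
    and succ2: "successively (cover_adj r) (w # c @ m # d)"
    and w: "w \<notin> set (a @ m # b)" "w \<notin> set (c @ m # d)"
    and dist: "distinct (a @ m # b)" "distinct (c @ m # d)"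
    and sub: "insert w (set (a @ m # b)) \<subseteq> A" "insert w (set (c @ m # d)) \<subseteq> A"
    using assms(1,2) ab cd unfolding cover_path_def by auto
  have c_rev: "successively (cover_adj r) (m # rev c)"
  proof -
    have "successively (cover_adj r) (c @ [m])"
      using succ2 by (auto simp: successively_Cons successively_append_iff)
    then have "successively (\<lambda>u v. cover_adj r v u) (rev (c @ [m]))"
      by (simp only: successively_rev)
    then show ?thesis by (auto elim: successively_mono intro: cover_adj_sym)
  qed
  have "successively (cover_adj r) ?c"
    using succ1 c_rev
    by (auto simp: successively_Cons successively_append_iff hd_append split: if_splits)
  moreover have "cover_adj r (last ?c) (hd ?c)"
  proof (cases c)
    case Nil
    then show ?thesis using succ2 by (auto intro: cover_adj_sym)
  next
    case (Cons e c')
    then show ?thesis using succ2 by (auto intro: cover_adj_sym)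
  qed
  moreover have "distinct ?c" using dist w a cd by auto
  moreover have "set ?c \<subseteq> A" using sub by auto
  moreover have "3 \<le> length ?c"
  proof -
    have "a \<noteq> [] \<or> c \<noteq> []" using ab cd assms(3) by auto
    then show ?thesis by (cases a; cases c) auto
  qed
  ultimately show ?thesis unfolding cover_cycle_def by blast
qed

lemma tree_poset_U_D_disjoint:
  assumes "tree_poset A r"
  shows "U_set A r w \<inter> D_set A r w = {}"
proof (rule ccontr)
  assume "\<not> ?thesis"
  then obtain t s p s' p' where
    p: "cover_path A r w (w # s # p) t" "s \<noteq> w" "(w, s) \<in> r" and
    p': "cover_path A r w (w # s' # p') t" "s' \<noteq> w" "(s', w) \<in> r"
    unfolding U_set_def D_set_def by blast
  have "antisym r" using assms unfolding tree_poset_def partial_order_on_def by blast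
  with p p' have "s \<noteq> s'" by (auto dest: antisymD)
  with two_first_steps_cycle[OF p(1) p'(1)] assms show False unfolding tree_poset_def by blast
qed

text \<open>
  If \<open>t'\<close> is on the path, the path is cut off there; otherwise it is extended by \<open>t'\<close>. In both
  cases its first step is kept since \<open>t'\<close> is not its starting point.
\<close>

lemma cover_path_step:
  assumes p: "cover_path A r w (w # s # p) t"
    and adj: "cover_adj r t t'" and t': "t' \<in> A" "t' \<noteq> w"
  obtains p' where "cover_path A r w (w # s # p') t'"
proof (cases "t' \<in> set (s # p)")
  case True
  then obtain a b where ab: "s # p = a @ t' # b" by (meson split_list)
  then have *: "w # s # p = (w # a @ [t']) @ b" by simp
  have "cover_path A r w (w # a @ [t']) t'"
    using p unfolding cover_path_def *
    by (auto simp: successively_Cons successively_append_iff hd_append split: if_splits)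
  moreover obtain p' where "a @ [t'] = s # p'" using ab by (cases a) auto
  ultimately show thesis using that by simp
next
  case False
  have "cover_path A r w ((w # s # p) @ [t']) t'"
    using p adj t' False unfolding cover_path_def successively_append_iff by auto
  then show thesis using that by simp
qed

lemma U_set_step:
  assumes "t \<in> U_set A r w" "cover_adj r t t'" "t' \<in> A" "t' \<noteq> w"
  shows "t' \<in> U_set A r w"
proof -
  obtain s p where p: "cover_path A r w (w # s # p) t" "s \<noteq> w" "(w, s) \<in> r"
    using assms(1) unfolding U_set_def by blast
  obtain p' where "cover_path A r w (w # s # p') t'"
    using cover_path_step[OF p(1) assms(2-4)] by blast
  with p assms(3,4) show ?thesis unfolding U_set_def by blast
qed

text \<open>
  Descent through the interval between \<open>a\<close> and \<open>b\<close>: covering pairs other than those at \<open>w\<close>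
  never join \<open>U\<close> to \<open>D\<close>, so there is an element \<open>t\<close> strictly between \<open>a\<close> and \<open>b\<close>. Unless
  \<open>t = w\<close>, it lies on the other side than one of \<open>a\<close> and \<open>b\<close>, with a smaller interval in between.
\<close>

lemma tree_poset_through_root:
  assumes tree: "tree_poset A r" "w \<in> A"
    and sides: "(a \<in> U_set A r w \<and> b \<in> D_set A r w) \<or> (a \<in> D_set A r w \<and> b \<in> U_set A r w)"
    and le: "(a, b) \<in> r"
  shows "(a, w) \<in> r \<and> (w, b) \<in> r"
  using sides le
proof (induction "card {t. (a, t) \<in> r \<and> (t, b) \<in> r}" arbitrary: a b rule: less_induct)
  case less
  have po: "partial_order_on A r" and fin: "finite A" using tree unfolding tree_poset_def by auto
  have trans: "trans r" and anti: "antisym r" and sub: "r \<subseteq> A \<times> A" and rf: "refl_on A r"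
    using po unfolding partial_order_on_def preorder_on_def by auto
  have disj: "U_set A r w \<inter> D_set A r w = {}" by (rule tree_poset_U_D_disjoint[OF tree(1)])
  have ab: "a \<noteq> b" "a \<in> A" "b \<in> A" "a \<noteq> w" "b \<noteq> w"
    using less.prems disj by (auto dest: in_U_set in_D_set)
  have "\<not> covers r a b"
    using less.prems(1) disj U_set_step[of a A r w b] U_set_step[of b A r w a] ab
    by (auto simp: cover_adj_def)
  then obtain t where t: "t \<noteq> a" "t \<noteq> b" "(a, t) \<in> r" "(t, b) \<in> r"
    using less.prems(2) ab unfolding covers_def by blast
  have smaller: "card {t'. (c, t') \<in> r \<and> (t', d) \<in> r} < card {t. (a, t) \<in> r \<and> (t, b) \<in> r}"
    if "(a, c) \<in> r" "(d, b) \<in> r" "(a \<noteq> c \<or> b \<noteq> d)" for c d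
  proof (rule psubset_card_mono)
    show "finite {t. (a, t) \<in> r \<and> (t, b) \<in> r}"
      using sub by (auto intro: finite_subset[OF _ fin])
    have "{t'. (c, t') \<in> r \<and> (t', d) \<in> r} \<subseteq> {t. (a, t) \<in> r \<and> (t, b) \<in> r}"
      using that trans by (auto dest: transD)
    moreover have "(a, a) \<in> r" "(b, b) \<in> r" using rf ab by (auto dest: refl_onD)
    then have "a \<in> {t. (a, t) \<in> r \<and> (t, b) \<in> r}" "b \<in> {t. (a, t) \<in> r \<and> (t, b) \<in> r}"
      using less.prems(2) by auto
    moreover have "\<not> ((c, a) \<in> r \<and> (b, d) \<in> r)" using that anti by (auto dest: antisymD)
    ultimately show "{t'. (c, t') \<in> r \<and> (t', d) \<in> r} \<subset> {t. (a, t) \<in> r \<and> (t, b) \<in> r}"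
      by blast
  qed
  have bb: "(b, b) \<in> r" "(a, a) \<in> r" using rf ab by (auto dest: refl_onD)
  have IH1: "(a, w) \<in> r \<and> (w, t) \<in> r" if "(a \<in> U_set A r w \<and> t \<in> D_set A r w) \<or> (a \<in> D_set A r w \<and> t \<in> U_set A r w)"
    using less.hyps[OF smaller[of a t] that] t bb by blast
  have IH2: "(t, w) \<in> r \<and> (w, b) \<in> r" if "(t \<in> U_set A r w \<and> b \<in> D_set A r w) \<or> (t \<in> D_set A r w \<and> b \<in> U_set A r w)"
    using less.hyps[OF smaller[of t b] that] t bb by blast
  have "t \<in> insert w (U_set A r w \<union> D_set A r w)"
    using tree_poset_decomposition[OF tree] t(3) sub by blast
  then consider "t = w"
    | "(a \<in> U_set A r w \<and> t \<in> D_set A r w) \<or> (a \<in> D_set A r w \<and> t \<in> U_set A r w)"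
    | "(t \<in> U_set A r w \<and> b \<in> D_set A r w) \<or> (t \<in> D_set A r w \<and> b \<in> U_set A r w)"
    using less.prems(1) by blast
  then show ?case
  proof cases
    case 1
    with t show ?thesis by simp
  next
    case 2
    from IH1[OF this] t(4) show ?thesis using transD[OF trans] by blast
  next
    case 3
    from IH2[OF this] t(3) show ?thesis using transD[OF trans] by blast
  qed
qed
section \<open>Admissible words\<close>

lemma extension_last_greatest:
  assumes "linear_extension S r (w @ [v])" "t \<in> S" "t \<noteq> v"
  shows "(v, t) \<notin> r"
  using assms unfolding linear_extension_def
  by (auto simp: word_order_append word_order_Cons dest: word_order_in_set)

lemma extension_first_least:
  assumes "linear_extension S r (v # w)" "t \<in> S" "t \<noteq> v"
  shows "(t, v) \<notin> r"
  using assms unfolding linear_extension_def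
  by (auto simp: word_order_Cons dest: word_order_in_set)

lemma realizer_iff:
  "realizer S r ws \<Longrightarrow> u \<in> S \<Longrightarrow> v \<in> S \<Longrightarrow>
    (u, v) \<in> r \<longleftrightarrow> (\<forall>w\<in>set ws. (u, v) \<in> word_order w)"
  by (simp add: realizer_def)

context
  fixes A :: "'a set" and r :: "'a rel" and w :: 'a and a :: "'a words"
  assumes rooted: "rooted_tree_poset A r w" and adm: "admissible_words A r w a"
begin

lemma root_le_root: "(w, w) \<in> r"
  using rooted unfolding rooted_tree_poset_def tree_poset_def partial_order_on_def preorder_on_def
  by (auto dest: refl_onD)

lemma U_not_le_root: "t \<in> U_set A r w \<Longrightarrow> (t, w) \<notin> r"
  using adm extension_first_least[of "U_set A r w \<union> {w}" r w "U_1 a" t]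
  by (auto simp: admissible_words_def realizer_def dest: in_U_set)

lemma root_not_le_D: "t \<in> D_set A r w \<Longrightarrow> (w, t) \<notin> r"
  using adm extension_last_greatest[of "D_set A r w \<union> {w}" r "D_1 a" w t]
  by (auto simp: admissible_words_def realizer_def dest: in_D_set)

lemma tree_decomposition:
  "A = insert w (U_set A r w \<union> D_set A r w)" "U_set A r w \<inter> D_set A r w = {}"
  "w \<notin> U_set A r w" "w \<notin> D_set A r w"
proof -
  have "tree_poset A r" "w \<in> A" using rooted by (simp_all add: rooted_tree_poset_def)
  from tree_poset_decomposition[OF this] tree_poset_U_D_disjoint[OF this(1)]
  show "A = insert w (U_set A r w \<union> D_set A r w)" "U_set A r w \<inter> D_set A r w = {}" .
  show "w \<notin> U_set A r w" "w \<notin> D_set A r w" by (auto dest: in_U_set in_D_set)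
qed

lemma set_admissible_words:
  "set (U_minus a) = {t \<in> U_set A r w. (w, t) \<notin> r}" "set (U_plus a) = {t \<in> U_set A r w. (w, t) \<in> r}"
  "set (U_1 a) = U_set A r w" "set (U_2 a) = U_set A r w"
  "set (D_minus a) = {t \<in> D_set A r w. (t, w) \<in> r}" "set (D_plus a) = {t \<in> D_set A r w. (t, w) \<notin> r}"
  "set (D_1 a) = D_set A r w" "set (D_2 a) = D_set A r w"
  using adm tree_decomposition(2-4)
  by (auto simp: admissible_words_def linear_extension_def U_minus_set_def U_plus_set_def
      D_minus_set_def D_plus_set_def)

text \<open>
  The admissible words glue to blocks that are described by the comparison with the root alone:
  nothing in \<open>U\<close> is below the root and nothing in \<open>D\<close> is above it.
\<close>

lemma set_grafted_blocks:
  "set (U_minus a @ D_1 a) = {t \<in> A. (w, t) \<notin> r}"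
  "set ([w] @ U_plus a) = {t \<in> A. (w, t) \<in> r}"
  "set (D_minus a @ [w]) = {t \<in> A. (t, w) \<in> r}"
  "set (U_1 a @ D_plus a) = {t \<in> A. (t, w) \<notin> r}"
  "set (D_2 a @ [w] @ U_2 a) = A"
proof -
  have "t \<in> A \<longleftrightarrow> t = w \<or> t \<in> U_set A r w \<or> t \<in> D_set A r w" for t
    using tree_decomposition(1) by blast
  then show
    "set (U_minus a @ D_1 a) = {t \<in> A. (w, t) \<notin> r}"
    "set ([w] @ U_plus a) = {t \<in> A. (w, t) \<in> r}"
    "set (D_minus a @ [w]) = {t \<in> A. (t, w) \<in> r}"
    "set (U_1 a @ D_plus a) = {t \<in> A. (t, w) \<notin> r}"
    "set (D_2 a @ [w] @ U_2 a) = A"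
    using U_not_le_root root_not_le_D root_le_root by (auto simp: set_admissible_words)
qed

lemma distinct_admissible_words:
  "distinct (U_minus a)" "distinct (U_plus a)" "distinct (U_1 a)" "distinct (U_2 a)"
  "distinct (D_minus a)" "distinct (D_plus a)" "distinct (D_1 a)" "distinct (D_2 a)"
  using adm by (auto simp: admissible_words_def linear_extension_def)

text \<open>
  On \<open>U \<union> {w}\<close> and on \<open>D \<union> {w}\<close> these words restrict to the given realizers. For \<open>s\<close> in \<open>D\<close> and \<open>t\<close>
  in \<open>U\<close>, the first word places \<open>s\<close> before \<open>t\<close> if and only if \<open>w \<le> t\<close>, the second if and only if
  \<open>s \<le> w\<close>, and the third always.
\<close>

lemma admissible_words_realizer:
  "realizer A r [U_minus a @ D_1 a @ [w] @ U_plus a,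
                 D_minus a @ [w] @ U_1 a @ D_plus a,
                 D_2 a @ [w] @ U_2 a]"
    (is "realizer A r [?\<alpha>, ?\<beta>, ?\<gamma>]")
proof (rule realizerI)
  fix v assume "v \<in> set [?\<alpha>, ?\<beta>, ?\<gamma>]"
  then have "distinct v"
    using distinct_admissible_words tree_decomposition(2-4)
    by (auto simp: set_admissible_words)
  moreover have "set v = insert w (U_set A r w \<union> D_set A r w)"
    using \<open>v \<in> set _\<close> U_not_le_root root_not_le_D by (auto simp: set_admissible_words)
  ultimately show "distinct v \<and> set v = A" by (simp flip: tree_decomposition(1))
next
  let ?U = "U_set A r w" and ?D = "D_set A r w"
  fix s t assume st: "s \<in> A" "t \<in> A"
  have U: "(s, t) \<in> r \<longleftrightarrow>
      (\<forall>v\<in>set [U_minus a @ [w] @ U_plus a, [w] @ U_1 a, [w] @ U_2 a]. (s, t) \<in> word_order v)"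
    if "s \<in> insert w ?U" "t \<in> insert w ?U"
    using adm that by (intro realizer_iff[of "?U \<union> {w}"]) (auto simp: admissible_words_def)
  have D: "(s, t) \<in> r \<longleftrightarrow>
      (\<forall>v\<in>set [D_minus a @ [w] @ D_plus a, D_1 a @ [w], D_2 a @ [w]]. (s, t) \<in> word_order v)"
    if "s \<in> insert w ?D" "t \<in> insert w ?D"
    using adm that by (intro realizer_iff[of "?D \<union> {w}"]) (auto simp: admissible_words_def)
  have tree: "tree_poset A r" "w \<in> A" using rooted unfolding rooted_tree_poset_def by auto
  have trans: "trans r"
    using tree unfolding tree_poset_def partial_order_on_def preorder_on_def by auto
  note facts = set_admissible_words word_order_append word_order_Cons word_order_notin
  consider "s \<in> insert w ?U \<and> t \<in> insert w ?U" | "s \<in> insert w ?D \<and> t \<in> insert w ?D"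
    | "s \<in> ?U" "t \<in> ?D" | "s \<in> ?D" "t \<in> ?U"
    using tree_decomposition(1) st by blast
  then show "(s, t) \<in> r \<longleftrightarrow> (\<forall>v\<in>set [?\<alpha>, ?\<beta>, ?\<gamma>]. (s, t) \<in> word_order v)"
  proof cases
    case 1
    then have "s \<notin> ?D" "t \<notin> ?D" using tree_decomposition(2-4) by auto
    then have "(s, t) \<in> word_order ?\<alpha> \<longleftrightarrow> (s, t) \<in> word_order (U_minus a @ [w] @ U_plus a)"
      "(s, t) \<in> word_order ?\<beta> \<longleftrightarrow> (s, t) \<in> word_order ([w] @ U_1 a)"
      "(s, t) \<in> word_order ?\<gamma> \<longleftrightarrow> (s, t) \<in> word_order ([w] @ U_2 a)"
      using word_order_skip[of s "D_1 a" t "U_minus a" "[w] @ U_plus a"]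
        word_order_skip[of s "D_minus a" t "[]" "[w] @ U_1 a @ D_plus a"]
        word_order_skip[of s "D_plus a" t "[w] @ U_1 a" "[]"]
        word_order_skip[of s "D_2 a" t "[]" "[w] @ U_2 a"]
      by (simp_all add: set_admissible_words)
    with U 1 show ?thesis by simp
  next
    case 2
    then have "s \<notin> ?U" "t \<notin> ?U" using tree_decomposition(2-4) by auto
    then have "(s, t) \<in> word_order ?\<alpha> \<longleftrightarrow> (s, t) \<in> word_order (D_1 a @ [w])"
      "(s, t) \<in> word_order ?\<beta> \<longleftrightarrow> (s, t) \<in> word_order (D_minus a @ [w] @ D_plus a)"
      "(s, t) \<in> word_order ?\<gamma> \<longleftrightarrow> (s, t) \<in> word_order (D_2 a @ [w])"
      using word_order_skip[of s "U_minus a" t "[]" "D_1 a @ [w] @ U_plus a"]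
        word_order_skip[of s "U_plus a" t "D_1 a @ [w]" "[]"]
        word_order_skip[of s "U_1 a" t "D_minus a @ [w]" "D_plus a"]
        word_order_skip[of s "U_2 a" t "D_2 a @ [w]" "[]"]
      by (simp_all add: set_admissible_words)
    with D 2 show ?thesis by auto
  next
    case 3
    then have "s \<notin> ?D" "t \<notin> ?U" "s \<noteq> w" "t \<noteq> w" using tree_decomposition(2-4) by auto
    moreover have "(s, t) \<notin> r"
      using tree_poset_through_root[OF tree, of s t] U_not_le_root 3 by blast
    moreover have "(s, t) \<notin> word_order ?\<gamma>"
      using calculation(1-4) by (simp add: facts)
    ultimately show ?thesis by simp
  next
    case 4
    then have "s \<notin> ?U" "t \<notin> ?D" "s \<noteq> w" "t \<noteq> w" using tree_decomposition(2-4) by auto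
    moreover have "(s, t) \<in> r \<longleftrightarrow> (s, w) \<in> r \<and> (w, t) \<in> r"
      using tree_poset_through_root[OF tree, of s t] transD[OF trans] 4 by blast
    moreover have "(s, t) \<in> word_order ?\<alpha> \<longleftrightarrow> (w, t) \<in> r"
      "(s, t) \<in> word_order ?\<beta> \<longleftrightarrow> (s, w) \<in> r" "(s, t) \<in> word_order ?\<gamma>"
      using calculation(1-4) 4 by (simp_all add: facts)
    ultimately show ?thesis by auto
  qed
qed

end

section \<open>Cycle posets\<close>

lemma chain_sorted:
  assumes "trans r" "antisym r" "successively (covers r) Y"
  shows "sorted_wrt (\<lambda>u v. (u, v) \<in> r \<and> u \<noteq> v) Y"
proof -
  have "successively (\<lambda>u v. (u, v) \<in> r \<and> u \<noteq> v) Y"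
    using assms(3) by (rule successively_mono) (auto simp: covers_def)
  moreover have "transp (\<lambda>u v. (u, v) \<in> r \<and> u \<noteq> v)"
    using assms(1,2) by (auto intro!: transpI elim: transE dest: antisymD)
  ultimately show ?thesis by (simp add: successively_conv_sorted_wrt)
qed

lemma sorted_wrt_neq_distinct: "sorted_wrt (\<lambda>u v. P u v \<and> u \<noteq> v) Y \<Longrightarrow> distinct Y"
  by (induction Y) auto

lemma cycle_poset_distinct:
  assumes "cycle_poset Q r x z Y1 Y2"
  shows "distinct (x # Y1 @ Y2 @ [z])"
proof -
  have po: "trans r" "antisym r" and refl: "refl_on Q r"
    and Q: "Q = set ([x] @ Y1 @ [z]) \<union> set ([x] @ Y2 @ [z])"
    and incomp: "\<forall>u\<in>set Y1. \<forall>v\<in>set Y2. (u, v) \<notin> r \<and> (v, u) \<notin> r"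
    and ch: "successively (covers r) ([x] @ Y1 @ [z])" "successively (covers r) ([x] @ Y2 @ [z])"
    using assms unfolding cycle_poset_def partial_order_on_def preorder_on_def by auto
  have "distinct ([x] @ Y1 @ [z])" "distinct ([x] @ Y2 @ [z])"
    using ch[THEN chain_sorted[OF po], THEN sorted_wrt_neq_distinct] .
  moreover have "set Y1 \<inter> set Y2 = {}"
    using incomp refl unfolding Q by (auto dest: refl_onD)
  ultimately show ?thesis by auto
qed

lemma cycle_poset_le_iff:
  assumes cyc: "cycle_poset Q r x z Y1 Y2" and "a \<in> Q" "c \<in> Q" "a \<noteq> c"
  shows "(a, c) \<in> r \<longleftrightarrow> a = x \<or> c = z \<or> (a, c) \<in> word_order Y1 \<or> (a, c) \<in> word_order Y2"
proof -
  have trans: "trans r" and anti: "antisym r"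
    and Q: "Q = set ([x] @ Y1 @ [z]) \<union> set ([x] @ Y2 @ [z])"
    and min: "\<forall>v\<in>Q. (x, v) \<in> r" and max: "\<forall>v\<in>Q. (v, z) \<in> r"
    and incomp: "\<forall>u\<in>set Y1. \<forall>v\<in>set Y2. (u, v) \<notin> r \<and> (v, u) \<notin> r"
    and ch: "successively (covers r) ([x] @ Y1 @ [z])" "successively (covers r) ([x] @ Y2 @ [z])"
    using cyc unfolding cycle_poset_def partial_order_on_def preorder_on_def by auto
  have chain: "(u, v) \<in> r" if "(u, v) \<in> word_order Y" "u \<noteq> v" "Y = Y1 \<or> Y = Y2" for u v Y
  proof -
    have "sorted_wrt (\<lambda>u v. (u, v) \<in> r \<and> u \<noteq> v) ([x] @ Y @ [z])"
      using ch that(3) chain_sorted[OF trans anti] by blast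
    then have "sorted_wrt (\<lambda>u v. (u, v) \<in> r \<and> u \<noteq> v) Y" by (simp add: sorted_wrt_append)
    from word_order_sorted_wrt[OF this that(1,2)] show ?thesis by simp
  qed
  show ?thesis
  proof
    assume le: "(a, c) \<in> r"
    have noback: "(c, a) \<notin> r" using le anti \<open>a \<noteq> c\<close> by (auto dest: antisymD)
    then have "a \<noteq> z" "c \<noteq> x" using assms(2,3) min max by auto
    then consider "a = x" | "c = z" | Y where "a \<in> set Y" "c \<in> set Y" "Y = Y1 \<or> Y = Y2"
      using assms(2,3) incomp le unfolding Q by auto
    then show "a = x \<or> c = z \<or> (a, c) \<in> word_order Y1 \<or> (a, c) \<in> word_order Y2"
    proof cases
      case 3
      then show ?thesis
        using word_order_total[of a Y c] chain[of c a Y] noback \<open>a \<noteq> c\<close> by blast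
    qed auto
  next
    assume "a = x \<or> c = z \<or> (a, c) \<in> word_order Y1 \<or> (a, c) \<in> word_order Y2"
    then show "(a, c) \<in> r" using assms(2-4) min max chain by blast
  qed
qed

section \<open>Realizers of a grafting on a cycle poset\<close>

text \<open>
  In comparisons with other trees, all that matters about an element of a tree is whether it is
  above its root and whether it is below its root (the root itself is both). So each word either
  cuts the tree at \<open>v\<close> into \<open>nhi v\<close> and \<open>hi v\<close>, the elements not above and above the root, or cuts it into \<open>lo v\<close> and
  \<open>nlo v\<close>, the elements below and not below the root, or keeps it together as \<open>al v\<close>. For each
  vertex, the three words do these three different things, so pairs inside one tree are settled by
  the realizer of that tree.

  Let \<open>v < v'\<close> on the cycle. The word that cuts the tree at \<open>v'\<close> as \<open>nhi v'\<close>, \<open>hi v'\<close> places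
  \<open>nhi v'\<close> before the whole tree at \<open>v\<close>. The word that cuts the tree at \<open>v\<close> as \<open>lo v\<close>, \<open>nlo v\<close>
  places \<open>nlo v\<close> after the whole tree at \<open>v'\<close>. All three words place elements below the root
  \<open>v\<close> before elements above the root \<open>v'\<close>. Hence the elements \<open>s\<close> at \<open>v\<close> and \<open>t\<close> at \<open>v'\<close> for
  which all words place \<open>s\<close> first are exactly those with \<open>s\<close> in \<open>lo v\<close> and \<open>t\<close> in \<open>hi v'\<close>, and
  the third word, which keeps the trees at \<open>v\<close> and \<open>v'\<close> in this order, rules out \<open>t \<le> s\<close>. Trees
  at incomparable vertices are placed in opposite orders by the first two words.
\<close>

lemma cycle_blocks_realizer:
  fixes Q :: "'b set" and T :: "'b \<Rightarrow> 'c set" and hi nhi lo nlo al :: "'b \<Rightarrow> 'c list"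
  defines "block \<equiv> \<lambda>f v. map (Pair v) (f v)"
  assumes cycle: "cycle_poset Q r x z Y1 Y2"
    and tree: "\<And>v. v \<in> Q \<Longrightarrow> realizer (T v) (R v) [nhi v @ hi v, lo v @ nlo v, al v]"
    and sets: "\<And>v. v \<in> Q \<Longrightarrow> set (hi v) = {t \<in> T v. (\<rho> v, t) \<in> R v}"
      "\<And>v. v \<in> Q \<Longrightarrow> set (nhi v) = {t \<in> T v. (\<rho> v, t) \<notin> R v}"
      "\<And>v. v \<in> Q \<Longrightarrow> set (lo v) = {t \<in> T v. (t, \<rho> v) \<in> R v}"
      "\<And>v. v \<in> Q \<Longrightarrow> set (nlo v) = {t \<in> T v. (t, \<rho> v) \<notin> R v}"
      "\<And>v. v \<in> Q \<Longrightarrow> set (al v) = T v"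
  shows "realizer (graft_carrier Q T) (graft_order Q r T R \<rho>)
    [down_prod Y1 (block nhi) @ block lo x @ up_prod Y1 (block hi) @
       up_prod Y2 (block lo) @ block al z @ down_prod Y2 (block nlo) @ block nlo x,
     block nhi z @ down_prod Y2 (block nhi) @ block al x @ up_prod Y2 (block hi) @
       up_prod Y1 (block lo) @ block hi z @ down_prod Y1 (block nlo),
     block nhi x @ block hi x @ up_prod Y1 (block al) @ up_prod Y2 (block al) @
       block lo z @ block nlo z]"
    (is "realizer _ _ [?L1, ?L2, ?L3]")
proof (rule realizerI)
  have Q: "Q = insert x (insert z (set Y1 \<union> set Y2))"
    using cycle unfolding cycle_poset_def by auto
  have dist: "distinct (x # Y1 @ Y2 @ [z])" by (rule cycle_poset_distinct[OF cycle])
  have fib: "fibre v ?L1 = (if v \<in> set Y1 then nhi v @ hi v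
      else if v \<in> insert x (set Y2) then lo v @ nlo v else if v = z then al v else [])"
    "fibre v ?L2 = (if v \<in> set Y1 then lo v @ nlo v
      else if v \<in> insert z (set Y2) then nhi v @ hi v else if v = x then al v else [])"
    "fibre v ?L3 = (if v = x then nhi v @ hi v else if v = z then lo v @ nlo v
      else if v \<in> set Y1 \<union> set Y2 then al v else [])" for v
    using dist by (auto simp: block_def up_prod_def down_prod_def fibre_concat)
  {
    fix L assume "L \<in> set [?L1, ?L2, ?L3]"
    then have L: "L = ?L1 \<or> L = ?L2 \<or> L = ?L3" by simp
    have in_Q: "fibre v L \<in> {nhi v @ hi v, lo v @ nlo v, al v}" if "v \<in> Q" for v
      using L that dist unfolding Q by (elim disjE) (simp_all only: fib, auto)
    have out_Q: "fibre v L = []" if "v \<notin> Q" for v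
      using L that unfolding Q by (elim disjE) (simp_all only: fib, auto)
    have fibre_L: "distinct (fibre v L) \<and> set (fibre v L) = T v" if "v \<in> Q" for v
    proof -
      have "\<forall>l\<in>{nhi v @ hi v, lo v @ nlo v, al v}. linear_extension (T v) (R v) l"
        using tree[OF that] by (simp add: realizer_def)
      from bspec[OF this in_Q[OF that]] show ?thesis by (simp add: linear_extension_def)
    qed
    have "distinct L"
    proof (rule distinct_if_fibres_distinct)
      show "distinct (fibre v L)" for v
        using fibre_L[of v] out_Q[of v] by (cases "v \<in> Q") auto
    qed
    moreover have "(v, t) \<in> set L \<longleftrightarrow> v \<in> Q \<and> t \<in> T v" for v t
      using fibre_L[of v] out_Q[of v] set_fibre[of t v L] by (cases "v \<in> Q") auto
    ultimately show "distinct L \<and> set L = graft_carrier Q T"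
      by (auto simp: graft_carrier_def)
  }
  fix u v assume "u \<in> graft_carrier Q T" "v \<in> graft_carrier Q T"
  then obtain a b c d where uv: "u = (a, b)" "v = (c, d)"
    and ac: "a \<in> Q" "c \<in> Q" and bd: "b \<in> T a" "d \<in> T c"
    by (auto simp: graft_carrier_def)
  show "(u, v) \<in> graft_order Q r T R \<rho> \<longleftrightarrow> (\<forall>L\<in>set [?L1, ?L2, ?L3]. (u, v) \<in> word_order L)"
  proof (cases "a = c")
    case True
    have "(u, v) \<in> graft_order Q r T R \<rho> \<longleftrightarrow> (b, d) \<in> R a"
      using True ac bd by (auto simp: graft_order_def graft_carrier_def uv)
    also have "\<dots> \<longleftrightarrow> (\<forall>l\<in>set [nhi a @ hi a, lo a @ nlo a, al a]. (b, d) \<in> word_order l)"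
      using realizer_iff[OF tree[OF ac(1)]] bd True by blast
    also have "\<dots> \<longleftrightarrow> (\<forall>L\<in>set [?L1, ?L2, ?L3]. (b, d) \<in> word_order (fibre a L))"
      using ac(1) dist unfolding Q list.set ball_simps fib by auto
    also have "\<dots> \<longleftrightarrow> (\<forall>L\<in>set [?L1, ?L2, ?L3]. (u, v) \<in> word_order L)"
      using True unfolding uv by (simp only: word_order_fibre)
    finally show ?thesis .
  next
    case False
    have xz: "x \<in> Q" "z \<in> Q" using Q by auto
    note blocks = sets[OF ac(1)] sets[OF ac(2)] sets[OF xz(1)] sets[OF xz(2)]
    have "(u, v) \<in> graft_order Q r T R \<rho> \<longleftrightarrow> (a, c) \<in> r \<and> (b, \<rho> a) \<in> R a \<and> (\<rho> c, d) \<in> R c"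
      using False ac bd by (auto simp: graft_order_def graft_carrier_def uv)
    also have "\<dots> \<longleftrightarrow> (\<forall>L\<in>set [?L1, ?L2, ?L3]. (u, v) \<in> word_order L)"
    proof -
      have reversed: "(c, a) \<in> word_order Y \<longleftrightarrow> (a, c) \<notin> word_order Y"
        if "a \<in> set Y" "c \<in> set Y" "Y = Y1 \<or> Y = Y2" for Y
        using word_order_total[of a Y c] word_order_antisym[of Y a c] that dist False by auto
      have regions: "(v = x \<and> v \<notin> set Y1 \<and> v \<notin> set Y2 \<and> v \<noteq> z) \<or>
          (v \<in> set Y1 \<and> v \<notin> set Y2 \<and> v \<noteq> x \<and> v \<noteq> z) \<or>
          (v \<in> set Y2 \<and> v \<notin> set Y1 \<and> v \<noteq> x \<and> v \<noteq> z) \<or>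
          (v = z \<and> v \<notin> set Y1 \<and> v \<notin> set Y2 \<and> v \<noteq> x)" if "v \<in> Q" for v
        using that dist unfolding Q by auto
      \<comment> \<open>Both sides become Boolean combinations of the positions of \<open>a\<close> and \<open>c\<close> on the cycle and of
        the relations of \<open>b\<close> and \<open>d\<close> to their roots; each of the sixteen choices of
        positions then leaves a tautology.\<close>
      show ?thesis
        unfolding cycle_poset_le_iff[OF cycle ac False]
        apply (simp add: uv block_def up_prod_def down_prod_def word_order_append
            word_order_concat[OF False] word_order_map_Pair[OF False] in_set_concat_map_Pair
            in_set_map_Pair word_order_rev blocks bd del: set_concat set_map)
        using regions[OF ac(1)] regions[OF ac(2)] False bd reversed[of Y1] reversed[of Y2]
        by (elim disjE conjE) (simp_all add: word_order_notin, blast+)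
    qed
    finally show ?thesis .
  qed
qed

theorem proposition9p4:
  fixes Q :: "'b set" and r :: "'b rel" and x z :: 'b and Y1 Y2 :: "'b list"
    and T :: "'b \<Rightarrow> 'c set" and R :: "'b \<Rightarrow> 'c rel" and \<rho> :: "'b \<Rightarrow> 'c"
    and adm :: "'b \<Rightarrow> 'c words"
  assumes "cycle_poset Q r x z Y1 Y2"
    and "\<And>v. v \<in> Q \<Longrightarrow> rooted_tree_poset (T v) (R v) (\<rho> v)"
    and "\<And>v. v \<in> Q \<Longrightarrow> admissible_words (T v) (R v) (\<rho> v) (adm v)"
  shows "let q = (\<lambda>v. (v, \<rho> v)); W = (\<lambda>v. map_words (Pair v) (adm v)) in
    realizer (graft_carrier Q T) (graft_order Q r T R \<rho>)
      [A_word q W Y1 (E_minus q W x) @ B_word q W Y2 (E_bullet q W z) @ I_plus W x,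
       I_minus W z @ A_word q W Y2 (E_bullet q W x) @ B_word q W Y1 (E_plus q W z),
       I_minus W x @ E_plus q W x @ C_word q W Y1 @ C_word q W Y2 @ E_minus q W z @ I_plus W z]"
proof -
  define hi where "hi = (\<lambda>v. [\<rho> v] @ U_plus (adm v))"
  define nhi where "nhi = (\<lambda>v. U_minus (adm v) @ D_1 (adm v))"
  define lo where "lo = (\<lambda>v. D_minus (adm v) @ [\<rho> v])"
  define nlo where "nlo = (\<lambda>v. U_1 (adm v) @ D_plus (adm v))"
  define al where "al = (\<lambda>v. D_2 (adm v) @ [\<rho> v] @ U_2 (adm v))"
  note block_defs = hi_def nhi_def lo_def nlo_def al_def
  have tree: "realizer (T v) (R v) [nhi v @ hi v, lo v @ nlo v, al v]" if "v \<in> Q" for v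
    using admissible_words_realizer[OF assms(2,3)[OF that]] by (simp add: block_defs)
  have sets: "set (hi v) = {t \<in> T v. (\<rho> v, t) \<in> R v}" "set (nhi v) = {t \<in> T v. (\<rho> v, t) \<notin> R v}"
    "set (lo v) = {t \<in> T v. (t, \<rho> v) \<in> R v}" "set (nlo v) = {t \<in> T v. (t, \<rho> v) \<notin> R v}"
    "set (al v) = T v" if "v \<in> Q" for v
    unfolding block_defs set_grafted_blocks[OF assms(2,3)[OF that]] by (rule refl)+
  show ?thesis
    using cycle_blocks_realizer[where T = T and R = R, OF assms(1) tree sets]
    by (simp add: block_defs Let_def A_word_def B_word_def C_word_def E_plus_def E_minus_def
        E_bullet_def I_plus_def I_minus_def up_prod_def down_prod_def words.map_sel)
qed

end
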